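(* Let $G$ be a finitely generated LERF group with positive rank gradient $\nabla G>0$, let $n\in\mathbb{N}$, and let $H_1,\dots,H_n$ be finitely generated subgroups of infinite index in $G$. Then $H_1H_2\cdots H_n\subsetneq G$, where $H_1H_2\cdots H_n=\{h_1h_2\cdots h_n : h_i\in H_i\}$.
   Context: For a group $U$, $d(U)$ denotes the minimal cardinality of a generating set of $U$. The rank gradient of a finitely generated group $G$ is $\nabla G=\inf_U \frac{d(U)-1}{[G:U]}$, where $U$ ranges over all finite index subgroups of $G$. A group $G$ is LERF (subgroup separable) if every finitely generated subgroup of $G$ is the intersection of some collection of finite index subgroups of $G$. *)

theory Defs
  imports "HOL-Algebra.Algebra" "HOL-Analysis.Analysis"
begin

definition fg_subgroup :: "('a, 'b) monoid_scheme \<Rightarrow> 'a set \<Rightarrow> bool" where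
  "fg_subgroup G H \<longleftrightarrow> subgroup H G \<and>
     (\<exists>S. finite S \<and> S \<subseteq> carrier G \<and> generate G S = H)"

definition fg_group :: "('a, 'b) monoid_scheme \<Rightarrow> bool" where
  "fg_group G \<longleftrightarrow> group G \<and> fg_subgroup G (carrier G)"

definition finite_index :: "('a, 'b) monoid_scheme \<Rightarrow> 'a set \<Rightarrow> bool" where
  "finite_index G H \<longleftrightarrow> subgroup H G \<and> finite (rcosets\<^bsub>G\<^esub> H)"

definition index :: "('a, 'b) monoid_scheme \<Rightarrow> 'a set \<Rightarrow> nat" where
  "index G H = card (rcosets\<^bsub>G\<^esub> H)"

definition rank :: "('a, 'b) monoid_scheme \<Rightarrow> 'a set \<Rightarrow> nat" where
  "rank G U = (LEAST n. \<exists>S. finite S \<and> card S = n \<and> S \<subseteq> U \<and> generate G S = U)"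

definition rank_gradient :: "('a, 'b) monoid_scheme \<Rightarrow> real" where
  "rank_gradient G = Inf {(real (rank G U) - 1) / real (index G U) | U. finite_index G U}"

definition LERF :: "('a, 'b) monoid_scheme \<Rightarrow> bool" where
  "LERF G \<longleftrightarrow> (\<forall>H. fg_subgroup G H \<longrightarrow>
     (\<exists>C. C \<noteq> {} \<and> (\<forall>K\<in>C. finite_index G K) \<and> H = \<Inter>C))"

fun prod_subgroups :: "('a, 'b) monoid_scheme \<Rightarrow> (nat \<Rightarrow> 'a set) \<Rightarrow> nat \<Rightarrow> 'a set" where
  "prod_subgroups G H 0 = {\<one>\<^bsub>G\<^esub>}"
| "prod_subgroups G H (Suc n) = prod_subgroups G H n <#>\<^bsub>G\<^esub> H n"

end

theory Submission
  imports Defs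
begin

text \<open>
  By LERF there is a normal subgroup \<open>U\<close> of finite index for which every \<open>[H\<^sub>i : H\<^sub>i \<inter> U]\<close> is a tiny
  fraction of \<open>[G : U]\<close>.  By Schreier's rank bound so is every \<open>d(H\<^sub>i \<inter> U)\<close>, hence also the rank of any
  subgroup \<open>L \<le> U\<close> generated by one conjugate of each \<open>H\<^sub>i \<inter> U\<close>; since \<open>d(L) - 1 \<ge> \<nabla>G [G : U]\<close>
  would hold if \<open>L\<close> had finite index, \<open>L\<close> has infinite index.  Splitting each \<open>H\<^sub>i\<close> into cosets of
  \<open>H\<^sub>i \<inter> U\<close> and collecting the representatives on the right covers \<open>H\<^sub>1 \<cdots> H\<^sub>n\<close> by finitely many
  cosets of such subgroups \<open>L\<close>, and these cannot cover \<open>G\<close>.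
\<close>

context group
begin

section \<open>Cosets, finite index and normal cores\<close>

lemma inv_mult_cancel_left:
  assumes "x \<in> carrier G" "y \<in> carrier G"
  shows "inv x \<otimes> (x \<otimes> y) = y"
  using assms by (simp flip: m_assoc)

lemma rcos_eq_iff:
  assumes "subgroup K G" "x \<in> carrier G" "y \<in> carrier G"
  shows "K #> x = K #> y \<longleftrightarrow> x \<otimes> inv y \<in> K"
proof
  assume "K #> x = K #> y"
  then have "x \<in> K #> y" using assms rcos_self by metis
  then obtain k where "k \<in> K" "x = k \<otimes> y" by (auto simp: r_coset_def)
  then show "x \<otimes> inv y \<in> K"
    using assms by (simp add: m_assoc subgroup.mem_carrier)
next
  assume *: "x \<otimes> inv y \<in> K"
  have "x = (x \<otimes> inv y) \<otimes> y" using assms by (simp add: m_assoc)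
  then have "x \<in> K #> y" using * by (auto simp: r_coset_def)
  then show "K #> x = K #> y" using repr_independence assms by metis
qed

lemma rcosets_eq_image: "rcosets K = (\<lambda>x. K #> x) ` carrier G"
  by (auto simp: RCOSETS_def)

text \<open>Each value of \<open>f\<close> determines a coset of \<open>K\<close>, so picking one
  preimage per value yields finitely many representatives. Finite index can thus be proved by naming
  a finite invariant that separates cosets.\<close>

lemma finite_rcosetsI:
  assumes "subgroup K G" "finite (f ` carrier G)"
    and "\<And>x y. x \<in> carrier G \<Longrightarrow> y \<in> carrier G \<Longrightarrow> f x = f y \<Longrightarrow> x \<otimes> inv y \<in> K"
  shows "finite (rcosets K)"
proof -
  define r where "r v = (SOME x. x \<in> carrier G \<and> f x = v)" for v
  have "rcosets K \<subseteq> (\<lambda>v. K #> r v) ` f ` carrier G"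
  proof
    fix C assume "C \<in> rcosets K"
    then obtain x where x: "x \<in> carrier G" "C = K #> x" by (auto simp: RCOSETS_def)
    have "r (f x) \<in> carrier G \<and> f (r (f x)) = f x"
      unfolding r_def by (rule someI[of _ x]) (use x in auto)
    then have "C = K #> r (f x)"
      using x assms rcos_eq_iff[of K x "r (f x)"] by metis
    then show "C \<in> (\<lambda>v. K #> r v) ` f ` carrier G" using x by blast
  qed
  then show ?thesis using assms(2) finite_surj by blast
qed

lemma finite_index_Int:
  assumes "finite_index G V" "finite_index G W"
  shows "finite_index G (V \<inter> W)"
proof -
  have sub: "subgroup V G" "subgroup W G" and fin: "finite (rcosets V)" "finite (rcosets W)"
    using assms by (auto simp: finite_index_def)
  have "subgroup (V \<inter> W) G" using sub by (rule subgroups_Inter_pair)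
  moreover have "finite (rcosets (V \<inter> W))"
  proof (rule finite_rcosetsI[where f = "\<lambda>x. (V #> x, W #> x)"])
    have "(\<lambda>x. (V #> x, W #> x)) ` carrier G \<subseteq> (rcosets V) \<times> (rcosets W)"
      by (auto simp: RCOSETS_def)
    then show "finite ((\<lambda>x. (V #> x, W #> x)) ` carrier G)"
      using fin finite_subset by blast
  qed (use sub calculation in \<open>auto simp: rcos_eq_iff\<close>)
  ultimately show ?thesis by (simp add: finite_index_def)
qed

text \<open>\<open>N\<close> is the intersection of all conjugates of all \<open>V i\<close>. It has
  finite index because it contains every element acting trivially, by right translation, on each of
  the finitely many finite coset spaces.\<close>

lemma exists_normal_core:
  assumes "finite I" and V: "\<And>i. i \<in> I \<Longrightarrow> finite_index G (V i)"
  shows "\<exists>N. N \<lhd> G \<and> finite_index G N \<and> (\<forall>i\<in>I. N \<subseteq> V i)"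
proof -
  define N where "N = {x \<in> carrier G. \<forall>i\<in>I. \<forall>a\<in>carrier G. a \<otimes> x \<otimes> inv a \<in> V i}"
  have sub: "subgroup (V i) G" and fin: "finite (rcosets (V i))" if "i \<in> I" for i
    using V[OF that] by (auto simp: finite_index_def)
  have N: "subgroup N G"
  proof (rule subgroupI)
    show "N \<subseteq> carrier G" by (auto simp: N_def)
    show "N \<noteq> {}" using sub by (auto simp: N_def subgroup.one_closed intro!: exI[of _ \<one>])
    fix x assume x: "x \<in> N"
    show "inv x \<in> N"
    proof -
      have "a \<otimes> inv x \<otimes> inv a = inv (a \<otimes> x \<otimes> inv a)" if "a \<in> carrier G" for a
        using x that by (simp add: N_def inv_mult_group m_assoc)
      then show ?thesis using x sub by (auto simp: N_def subgroup.m_inv_closed)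
    qed
    fix y assume y: "y \<in> N"
    have "a \<otimes> (x \<otimes> y) \<otimes> inv a = (a \<otimes> x \<otimes> inv a) \<otimes> (a \<otimes> y \<otimes> inv a)" if "a \<in> carrier G" for a
      using x y that by (simp add: N_def m_assoc inv_mult_cancel_left)
    then show "x \<otimes> y \<in> N" using x y sub by (auto simp: N_def subgroup.m_closed)
  qed
  have "N \<lhd> G" unfolding normal_inv_iff
  proof (intro conjI ballI N)
    fix x h assume x: "x \<in> carrier G" and h: "h \<in> N"
    have hG: "h \<in> carrier G" using h by (simp add: N_def)
    have "a \<otimes> (x \<otimes> h \<otimes> inv x) \<otimes> inv a = (a \<otimes> x) \<otimes> h \<otimes> inv (a \<otimes> x)" if "a \<in> carrier G" for a
      using x hG that by (simp add: m_assoc inv_mult_group)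
    then show "x \<otimes> h \<otimes> inv x \<in> N" using x h by (auto simp: N_def)
  qed
  moreover have "finite (rcosets N)"
  proof (rule finite_rcosetsI[OF N])
    \<comment> \<open>The invariant of \<open>x\<close> is the family of maps that right translation
      by \<open>x\<close> induces on the coset spaces. Evaluating it at the coset of
      \<open>a\<close> tests membership of the conjugate by \<open>a\<close>.\<close>
    let ?f = "\<lambda>x. \<lambda>i\<in>I. \<lambda>C\<in>rcosets (V i). C #> x"
    have "C #> x \<in> rcosets (V i)" if "C \<in> rcosets (V i)" "i \<in> I" "x \<in> carrier G" for C x i
      using that sub[OF that(2)] by (auto simp: RCOSETS_def coset_mult_assoc subgroup.subset)
    then have "?f ` carrier G \<subseteq> (\<Pi>\<^sub>E i\<in>I. rcosets (V i) \<rightarrow>\<^sub>E rcosets (V i))"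
      by auto
    moreover have "finite (\<Pi>\<^sub>E i\<in>I. rcosets (V i) \<rightarrow>\<^sub>E rcosets (V i))"
      using \<open>finite I\<close> fin by (intro finite_PiE) auto
    ultimately show "finite (?f ` carrier G)" using finite_subset by blast
    fix x y assume xy: "x \<in> carrier G" "y \<in> carrier G" "?f x = ?f y"
    have "a \<otimes> (x \<otimes> inv y) \<otimes> inv a \<in> V i" if i: "i \<in> I" and a: "a \<in> carrier G" for i a
    proof -
      have C: "V i #> a \<in> rcosets (V i)" using a by (auto simp: RCOSETS_def)
      have "(V i #> a) #> x = (V i #> a) #> y"
        using fun_cong[OF fun_cong[OF xy(3), of i], of "V i #> a"] i C by simp
      then have "V i #> (a \<otimes> x) = V i #> (a \<otimes> y)"
        using sub[OF i] a xy by (simp add: coset_mult_assoc subgroup.subset)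
      then have "(a \<otimes> x) \<otimes> inv (a \<otimes> y) \<in> V i"
        using rcos_eq_iff[OF sub[OF i]] a xy by simp
      then show ?thesis using a xy by (simp add: m_assoc inv_mult_group)
    qed
    then show "x \<otimes> inv y \<in> N" using xy by (auto simp: N_def)
  qed
  moreover have "N \<subseteq> V i" if "i \<in> I" for i
  proof
    fix x assume "x \<in> N"
    then have "\<one> \<otimes> x \<otimes> inv \<one> \<in> V i" "x \<in> carrier G" using that unfolding N_def by blast+
    then show "x \<in> V i" by simp
  qed
  ultimately show ?thesis using N by (auto simp: finite_index_def)
qed

section \<open>Counting cosets, and finite-index overgroups in LERF groups\<close>

text \<open>This refines [G : U] = [G : V] [V : U]: the cosets of \<open>U\<close> that meet
  \<open>H\<close> are among the [V : U] cosets lying in \<open>V\<close>. \<open>H\<close> is only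
  a subset, so that the count applies to one or two elements as well as to a subgroup, where it
  counts [H : H \<inter> U].\<close>

lemma card_rcosets_mult_le:
  assumes V: "subgroup V G" and U: "subgroup U G" and UV: "U \<subseteq> V" and HV: "H \<subseteq> V"
    and fin: "finite (rcosets U)"
  shows "card ((\<lambda>h. U #> h) ` H) * card (rcosets V) \<le> card (rcosets U)"
proof -
  define r where "r C = (SOME x. x \<in> carrier G \<and> C = V #> x)" for C
  have r: "r C \<in> carrier G" "V #> r C = C" if "C \<in> rcosets V" for C
  proof -
    have "r C \<in> carrier G \<and> C = V #> r C"
      unfolding r_def by (rule someI_ex) (use that in \<open>auto simp: RCOSETS_def\<close>)
    then show "r C \<in> carrier G" "V #> r C = C" by auto
  qed
  have VG: "V \<subseteq> carrier G" and UG: "U \<subseteq> carrier G" using V U by (auto simp: subgroup.subset)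
  let ?A = "(\<lambda>h. U #> h) ` H"
  let ?f = "\<lambda>(D, C). D #> r C"
  have eq: "(U #> h) #> r C = U #> (h \<otimes> r C)" if "h \<in> H" "C \<in> rcosets V" for h C
    using that r HV VG UG by (intro coset_mult_assoc) auto
  have "inj_on ?f (?A \<times> rcosets V)"
  proof (rule inj_onI, clarify)
    fix h C h' C' assume h: "h \<in> H" "h' \<in> H" and C: "C \<in> rcosets V" "C' \<in> rcosets V"
      and e: "(U #> h) #> r C = (U #> h') #> r C'"
    have hV: "h \<in> V" "h' \<in> V" and hG: "h \<in> carrier G" "h' \<in> carrier G" using h HV VG by auto
    have "U #> (h \<otimes> r C) = U #> (h' \<otimes> r C')" using e eq h C by simp
    then have "(h \<otimes> r C) \<otimes> inv (h' \<otimes> r C') \<in> U"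
      using rcos_eq_iff[OF U] r C hG by simp
    \<comment> \<open>Enlarging \<open>U\<close> to \<open>V\<close> absorbs \<open>h\<close> and
      \<open>h'\<close>, so the translated coset determines \<open>C\<close>. Cancelling
      \<open>r C\<close> then recovers the coset of \<open>h\<close>.\<close>
    then have "(h \<otimes> r C) \<otimes> inv (h' \<otimes> r C') \<in> V" using UV by auto
    then have "V #> (h \<otimes> r C) = V #> (h' \<otimes> r C')"
      using rcos_eq_iff[OF V] r C hG by simp
    then have "(V #> h) #> r C = (V #> h') #> r C'"
      using hG C r VG by (simp add: coset_mult_assoc)
    moreover have "V #> h = V" "V #> h' = V"
      using coset_join2[OF _ V] hV hG by auto
    ultimately have CC: "C = C'" using r C by simp
    have "((U #> h) #> r C) #> inv (r C) = ((U #> h') #> r C) #> inv (r C)"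
      using e CC by simp
    moreover have "((U #> k) #> r C) #> inv (r C) = U #> k" if "k \<in> carrier G" for k
      using that r C UG by (simp add: coset_mult_assoc m_assoc)
    ultimately show "U #> h = U #> h' \<and> C = C'" using CC hG by auto
  qed
  moreover have "?f ` (?A \<times> rcosets V) \<subseteq> rcosets U"
  proof clarify
    fix h C assume "h \<in> H" "C \<in> rcosets V"
    then show "(U #> h) #> r C \<in> rcosets U"
      using eq r HV VG by (auto simp: rcosets_eq_image intro!: imageI)
  qed
  ultimately have "card (?A \<times> rcosets V) \<le> card (rcosets U)"
    using fin by (metis card_inj_on_le)
  then show ?thesis by (simp add: card_cartesian_product)
qed

text \<open>If the indices of the finite-index overgroups of \<open>H\<close> were bounded, one of
  maximal index would lie in every member of the LERF family, hence equal \<open>H\<close>, whose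
  index is infinite.\<close>

lemma exists_finite_index_large:
  assumes "LERF G" and H: "fg_subgroup G H" and inf: "infinite (rcosets H)"
  shows "\<exists>V. finite_index G V \<and> H \<subseteq> V \<and> m \<le> index G V"
proof (rule ccontr)
  assume "\<not> ?thesis"
  then have bound: "index G V < m" if "finite_index G V" "H \<subseteq> V" for V
    using that by (meson not_le)
  obtain C where C: "C \<noteq> {}" "\<And>K. K \<in> C \<Longrightarrow> finite_index G K" "H = \<Inter>C"
    using assms(1) H unfolding LERF_def by metis
  let ?P = "\<lambda>V. finite_index G V \<and> H \<subseteq> V"
  obtain K0 where "?P K0" using C by blast
  then obtain V where V: "?P V" and max: "\<And>W. ?P W \<Longrightarrow> index G W \<le> index G V"
    using ex_has_greatest_nat[of ?P K0 "index G" m] bound by (metis less_imp_le)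
  \<comment> \<open>Intersecting \<open>V\<close> with \<open>K\<close> cannot increase the index, which is maximal.\<close>
  have "V \<subseteq> K" if K: "K \<in> C" for K
  proof
    fix v assume v: "v \<in> V"
    let ?W = "V \<inter> K"
    have W: "?P ?W" using V C K finite_index_Int by blast
    have sub: "subgroup V G" "subgroup ?W G" "finite (rcosets ?W)" "finite (rcosets V)"
      using W V by (auto simp: finite_index_def)
    have vG: "v \<in> carrier G" using subgroup.mem_carrier[OF sub(1) v] .
    have ne: "card (rcosets V) > 0"
      using sub vG by (auto simp: card_gt_0_iff RCOSETS_def)
    \<comment> \<open>If \<open>v\<close> were outside \<open>K\<close>, then \<open>\<one>\<close>
      and \<open>v\<close> would lie in different cosets of \<open>?W\<close>, and the index would
      at least double.\<close>
    have "card ((\<lambda>h. ?W #> h) ` {\<one>, v}) * card (rcosets V) \<le> card (rcosets ?W)"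
      by (rule card_rcosets_mult_le) (use sub v in \<open>auto simp: subgroup.one_closed\<close>)
    also have "\<dots> \<le> card (rcosets V)" using max[OF W] by (simp add: index_def)
    finally have "card {?W #> \<one>, ?W #> v} \<le> 1" using ne by simp
    then have "?W #> v = ?W #> \<one>" by (auto simp: card_insert_if split: if_splits)
    then have "v \<otimes> inv \<one> \<in> ?W" using rcos_eq_iff[OF sub(2)] vG by blast
    then show "v \<in> K" using vG by simp
  qed
  then have "V = H" using C V by blast
  then show False using inf V by (simp add: finite_index_def)
qed

section \<open>Schreier generators\<close>

text \<open>\<open>S'\<close> consists of the Schreier elements, one for each pair of a generator
  and a coset of \<open>U\<close> meeting \<open>generate G S\<close>. The conclusion records what
  the product argument consumes: a bound on the number of generators, and a cover by finitely many
  cosets.\<close>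

lemma Schreier_generators:
  assumes SG: "S \<subseteq> carrier G" and S: "finite S" and U: "subgroup U G"
    and fin: "finite ((\<lambda>h. U #> h) ` generate G S)"
  shows "\<exists>S' T. finite S' \<and> S' \<subseteq> U \<and> card S' \<le> card S * card ((\<lambda>h. U #> h) ` generate G S)
    \<and> finite T \<and> T \<subseteq> carrier G \<and> generate G S \<subseteq> (\<Union>t\<in>T. generate G S' #> t)"
proof -
  let ?H = "generate G S"
  let ?X = "(\<lambda>h. U #> h) ` ?H"
  have H: "subgroup ?H G" using generate_is_subgroup[OF SG] .
  have HG: "?H \<subseteq> carrier G" and UG: "U \<subseteq> carrier G" using H U by (auto simp: subgroup.subset)
  \<comment> \<open>The representative of \<open>U\<close> itself is fixed as \<open>\<one>\<close>,
    so that the Schreier expression of \<open>h\<close> at \<open>U\<close> is just \<open>h\<close>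
    times the inverse of a representative.\<close>
  define r where "r C = (if C = U then \<one> else SOME h. h \<in> ?H \<and> C = U #> h)" for C
  have r: "r C \<in> ?H" "U #> r C = C" if "C \<in> ?X" for C
  proof -
    have "(SOME h. h \<in> ?H \<and> C = U #> h) \<in> ?H \<and> C = U #> (SOME h. h \<in> ?H \<and> C = U #> h)"
      by (rule someI_ex) (use that in auto)
    then show "r C \<in> ?H" "U #> r C = C" using H UG by (auto simp: r_def subgroup.one_closed)
  qed
  have rG: "r C \<in> carrier G" if "C \<in> ?X" for C using r that HG by blast
  have X: "C #> h \<in> ?X" if "C \<in> ?X" "h \<in> ?H" for C h
    using that HG UG H by (auto simp: coset_mult_assoc subsetD subgroup.m_closed intro!: imageI)
  define S' where "S' = (\<lambda>(C, s). r C \<otimes> s \<otimes> inv (r (C #> s))) ` (?X \<times> S)"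
  have gS: "s \<in> ?H" if "s \<in> S" for s using that by (rule generate.incl)
  have S'U: "S' \<subseteq> U"
  proof -
    have "r C \<otimes> s \<otimes> inv (r (C #> s)) \<in> U" if C: "C \<in> ?X" and s: "s \<in> S" for C s
    proof -
      have sG: "s \<in> carrier G" using s SG by auto
      have "U #> (r C \<otimes> s) = (U #> r C) #> s" using rG[OF C] sG UG by (simp add: coset_mult_assoc)
      also have "\<dots> = U #> r (C #> s)" using r(2)[OF C] r(2)[OF X[OF C gS[OF s]]] by simp
      finally show ?thesis
        using rcos_eq_iff[OF U] rG[OF C] sG rG[OF X[OF C gS[OF s]]] by simp
    qed
    then show ?thesis by (auto simp: S'_def)
  qed
  have L: "subgroup (generate G S') G" using generate_is_subgroup S'U UG by blast
  \<comment> \<open>Quantifying over all cosets \<open>C\<close>, not just \<open>U\<close>, makes the claim telescope over products and inverses.\<close>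
  have key: "\<forall>C\<in>?X. r C \<otimes> h \<otimes> inv (r (C #> h)) \<in> generate G S'" if "h \<in> ?H" for h
    using that
  proof (induction h rule: generate.induct)
    case one
    have "C #> \<one> = C" if "C \<in> ?X" for C using that HG UG by (auto simp: coset_mult_assoc subsetD)
    then show ?case using rG by (auto simp: generate.one)
  next
    case (incl s)
    then show ?case by (auto simp: S'_def intro!: generate.incl)
  next
    case (inv s)
    have sG: "s \<in> carrier G" using inv SG by auto
    show ?case
    proof
      fix C assume C: "C \<in> ?X"
      have iH: "inv s \<in> ?H" using inv by (rule generate.inv)
      let ?D = "C #> inv s"
      have D: "?D \<in> ?X" using X[OF C iH] .
      have CG: "C \<subseteq> carrier G" using C HG UG r_coset_subset_G by blast
      \<comment> \<open>The element for \<open>inv s\<close> at \<open>C\<close> is the inverse of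
        the Schreier generator for \<open>s\<close> at \<open>?D\<close>.\<close>
      have "?D #> s = C" using CG sG by (simp add: coset_mult_assoc)
      then have "r ?D \<otimes> s \<otimes> inv (r C) \<in> generate G S'"
        using D inv by (force simp: S'_def intro!: generate.incl)
      then have "inv (r ?D \<otimes> s \<otimes> inv (r C)) \<in> generate G S'"
        using L by (simp add: subgroup.m_inv_closed)
      then show "r C \<otimes> inv s \<otimes> inv (r ?D) \<in> generate G S'"
        using rG[OF C] rG[OF D] sG by (simp add: inv_mult_group m_assoc)
    qed
  next
    case (eng h1 h2)
    have hG: "h1 \<in> carrier G" "h2 \<in> carrier G" using eng HG by auto
    show ?case
    proof
      fix C assume C: "C \<in> ?X"
      have CG: "C \<subseteq> carrier G" using C HG UG r_coset_subset_G by blast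
      let ?D = "C #> h1" and ?E = "C #> (h1 \<otimes> h2)"
      have D: "?D \<in> ?X" using X C eng by blast
      have DE: "?D #> h2 = ?E" using CG hG by (simp add: coset_mult_assoc)
      have E: "?E \<in> ?X" using X D eng DE by metis
      have "(r C \<otimes> h1 \<otimes> inv (r ?D)) \<otimes> (r ?D \<otimes> h2 \<otimes> inv (r ?E)) \<in> generate G S'"
        using eng.IH C D DE by (metis generate.eng)
      moreover have "(r C \<otimes> h1 \<otimes> inv (r ?D)) \<otimes> (r ?D \<otimes> h2 \<otimes> inv (r ?E))
          = r C \<otimes> (h1 \<otimes> h2) \<otimes> inv (r ?E)"
        using rG[OF C] rG[OF D] rG[OF E] hG by (simp add: m_assoc inv_mult_cancel_left)
      ultimately show "r C \<otimes> (h1 \<otimes> h2) \<otimes> inv (r ?E) \<in> generate G S'" by simp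
    qed
  qed
  have UX: "U \<in> ?X" using H UG by (auto intro!: image_eqI[of _ _ \<one>] subgroup.one_closed)
  \<comment> \<open>Specialising \<open>key\<close> to the coset \<open>U\<close> shows that the
    chosen representatives can serve as \<open>T\<close>.\<close>
  have "h \<in> generate G S' #> r (U #> h)" if h: "h \<in> ?H" for h
  proof -
    have hG: "h \<in> carrier G" and Uh: "U #> h \<in> ?X" using h HG by auto
    have "r U \<otimes> h \<otimes> inv (r (U #> h)) \<in> generate G S'" using key h UX by blast
    then have "h \<otimes> inv (r (U #> h)) \<in> generate G S'" using hG by (simp add: r_def)
    moreover have "h = (h \<otimes> inv (r (U #> h))) \<otimes> r (U #> h)"
      using hG rG[OF Uh] by (simp add: m_assoc)
    ultimately show ?thesis by (auto simp: r_coset_def)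
  qed
  then have "?H \<subseteq> (\<Union>t\<in>r ` ?X. generate G S' #> t)" by blast
  moreover have "card S' \<le> card S * card ?X"
    using card_image_le[of "?X \<times> S"] S fin unfolding S'_def
    by (simp add: card_cartesian_product mult.commute)
  moreover have "finite S'" using S fin by (simp add: S'_def)
  ultimately show ?thesis using S'U fin rG
    by (intro exI[of _ S'] exI[of _ "r ` ?X"]) auto
qed

section \<open>Finite covers by cosets\<close>

text \<open>A LERF form of B. H. Neumann's covering lemma, proved by density. If all the subgroups
  had infinite index, each could be enlarged to one of index above the number of pieces, and the
  enlarged cosets would be too sparse to fill the cosets of a common finite-index
  \<open>W\<close>.\<close>

lemma finite_coset_cover_finite_index:
  assumes lerf: "LERF G" and F: "finite F"
    and fg: "\<And>L g. (L, g) \<in> F \<Longrightarrow> fg_subgroup G L"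
    and gG: "\<And>L g. (L, g) \<in> F \<Longrightarrow> g \<in> carrier G"
    and cover: "carrier G \<subseteq> (\<Union>(L, g)\<in>F. L #> g)"
  shows "\<exists>(L, g)\<in>F. finite (rcosets L)"
proof (rule ccontr)
  assume "\<not> ?thesis"
  then have inf: "infinite (rcosets L)" if "(L, g) \<in> F" for L g using that by auto
  \<comment> \<open>Index at least \<open>Suc (card F)\<close> keeps the total density at most
    \<open>card F / Suc (card F)\<close>, which is below 1.\<close>
  have "\<exists>V. finite_index G V \<and> fst p \<subseteq> V \<and> Suc (card F) \<le> index G V" if "p \<in> F" for p
    using exists_finite_index_large[OF lerf] fg inf that by (metis prod.collapse)
  then obtain V where V: "\<And>p. p \<in> F \<Longrightarrow> finite_index G (V p)" "\<And>p. p \<in> F \<Longrightarrow> fst p \<subseteq> V p"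
      "\<And>p. p \<in> F \<Longrightarrow> Suc (card F) \<le> index G (V p)"
    by metis
  obtain W where W: "W \<lhd> G" "finite_index G W" "\<And>p. p \<in> F \<Longrightarrow> W \<subseteq> V p"
    using exists_normal_core[OF F, of V] V(1) by blast
  have Ws: "subgroup W G" "finite (rcosets W)" using W by (auto simp: finite_index_def)
  have WG: "W \<subseteq> carrier G" using Ws by (simp add: subgroup.subset)
  have Vs: "subgroup (V p) G" if "p \<in> F" for p using V that by (auto simp: finite_index_def)
  have VG: "V p \<subseteq> carrier G" if "p \<in> F" for p using Vs that by (simp add: subgroup.subset)
  let ?A = "\<lambda>p. (\<lambda>h. W #> h) ` V p"
  \<comment> \<open>For \<open>p = (L, g)\<close>, this contains every coset of \<open>W\<close>
    that meets \<open>L #> g\<close>.\<close>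
  let ?B = "\<lambda>p. (\<lambda>D. D #> snd p) ` ?A p"
  have finA: "finite (?A p)" if "p \<in> F" for p
    by (rule finite_subset[OF _ Ws(2)]) (use VG[OF that] in \<open>auto simp: rcosets_eq_image\<close>)
  have "rcosets W \<subseteq> (\<Union>p\<in>F. ?B p)"
  proof
    fix D assume "D \<in> rcosets W"
    then obtain x where x: "x \<in> carrier G" "D = W #> x" by (auto simp: RCOSETS_def)
    then obtain L g where p: "(L, g) \<in> F" "x \<in> L #> g" using cover by auto
    then obtain l where l: "l \<in> L" "x = l \<otimes> g" by (auto simp: r_coset_def)
    have lV: "l \<in> V (L, g)" using V(2)[OF p(1)] l by auto
    have "D = (W #> l) #> g"
      using x l lV VG[OF p(1)] gG[OF p(1)] WG by (auto simp: coset_mult_assoc)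
    then have "D \<in> ?B (L, g)" using lV by auto
    then show "D \<in> (\<Union>p\<in>F. ?B p)" using p by blast
  qed
  then have "card (rcosets W) \<le> card (\<Union>p\<in>F. ?B p)"
    using F finA by (intro card_mono) auto
  also have "\<dots> \<le> (\<Sum>p\<in>F. card (?B p))" using F by (rule card_UN_le)
  also have "\<dots> \<le> (\<Sum>p\<in>F. card (?A p))"
    by (intro sum_mono card_image_le finA)
  finally have le: "card (rcosets W) \<le> (\<Sum>p\<in>F. card (?A p))" .
  have each: "card (?A p) * Suc (card F) \<le> card (rcosets W)" if "p \<in> F" for p
  proof -
    have "card (?A p) * Suc (card F) \<le> card (?A p) * card (rcosets (V p))"
      using V(3)[OF that] by (simp add: index_def del: mult_Suc_right)
    also have "\<dots> \<le> card (rcosets W)"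
      using card_rcosets_mult_le[OF Vs[OF that] Ws(1) W(3)[OF that] subset_refl Ws(2)] .
    finally show ?thesis .
  qed
  have "card (rcosets W) * Suc (card F) \<le> (\<Sum>p\<in>F. card (?A p) * Suc (card F))"
    using mult_le_mono1[OF le, of "Suc (card F)"] by (simp only: sum_distrib_right)
  also have "\<dots> \<le> (\<Sum>p\<in>F. card (rcosets W))" by (intro sum_mono each)
  finally have "card (rcosets W) = 0" by simp
  moreover have "W #> \<one> \<in> rcosets W" by (auto simp: RCOSETS_def)
  ultimately show False using Ws by auto
qed

section \<open>Products of subgroups as unions of cosets\<close>

lemma conj_mem_generate:
  assumes "A \<subseteq> carrier G" "g \<in> carrier G" "h \<in> generate G A"
  shows "g \<otimes> h \<otimes> inv g \<in> generate G ((\<lambda>a. g \<otimes> a \<otimes> inv g) ` A)"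
  using assms(3)
proof (induction h rule: generate.induct)
  case one
  then show ?case using assms by (simp add: generate.one)
next
  case (incl h)
  then show ?case by (auto intro: generate.incl)
next
  case (inv h)
  then have "inv (g \<otimes> h \<otimes> inv g) \<in> generate G ((\<lambda>a. g \<otimes> a \<otimes> inv g) ` A)"
    by (auto intro: generate.inv)
  moreover have "h \<in> carrier G" using inv assms by auto
  ultimately show ?case using assms by (simp add: inv_mult_group m_assoc)
next
  case (eng h1 h2)
  have "h1 \<in> carrier G" "h2 \<in> carrier G" using eng generate_in_carrier assms(1) by auto
  then have "g \<otimes> (h1 \<otimes> h2) \<otimes> inv g = (g \<otimes> h1 \<otimes> inv g) \<otimes> (g \<otimes> h2 \<otimes> inv g)"
    using assms by (simp add: m_assoc inv_mult_cancel_left)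
  then show ?case using generate.eng[OF eng.IH] by simp
qed

text \<open>Since \<open>g \<otimes> k \<otimes> t = (g \<otimes> k \<otimes> inv g) \<otimes> (g
  \<otimes> t)\<close>, a new factor can be moved left past \<open>g\<close> at the price of
  conjugation. This adds at most \<open>card (S n)\<close> generators, and normality keeps them in
  \<open>U\<close>. The number of pieces grows with each factor, but the generators of each piece
  stay bounded by the sum.\<close>

lemma prod_subgroups_coset_cover:
  assumes U: "U \<lhd> G"
    and "\<forall>i<n. finite (S i) \<and> S i \<subseteq> U \<and> finite (T i) \<and> T i \<subseteq> carrier G
      \<and> H i \<subseteq> (\<Union>t\<in>T i. generate G (S i) #> t)"
  shows "\<exists>F. finite F
    \<and> (\<forall>(A, g)\<in>F. finite A \<and> A \<subseteq> U \<and> card A \<le> (\<Sum>i<n. card (S i)) \<and> g \<in> carrier G)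
    \<and> prod_subgroups G H n \<subseteq> (\<Union>(A, g)\<in>F. generate G A #> g)"
  using assms(2)
proof (induction n)
  case 0
  show ?case
    by (rule exI[of _ "{({}, \<one>)}"]) (auto simp: generate_empty r_coset_def)
next
  case (Suc n)
  obtain F where F: "finite F"
      "prod_subgroups G H n \<subseteq> (\<Union>(A, g)\<in>F. generate G A #> g)"
    and "\<forall>(A, g)\<in>F. finite A \<and> A \<subseteq> U \<and> card A \<le> (\<Sum>i<n. card (S i)) \<and> g \<in> carrier G"
    using Suc.IH[OF conjunct2[OF Suc.prems[unfolded All_less_Suc]]] by (elim exE conjE) (rule that)
  then have FA: "finite A \<and> A \<subseteq> U \<and> card A \<le> (\<Sum>i<n. card (S i)) \<and> g \<in> carrier G"
    if "(A, g) \<in> F" for A g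
    using that by fast
  have Sn: "finite (S n)" "S n \<subseteq> U" and Tn: "finite (T n)" "T n \<subseteq> carrier G"
    and Hn: "H n \<subseteq> (\<Union>t\<in>T n. generate G (S n) #> t)"
    using Suc.prems by auto
  have UG: "U \<subseteq> carrier G" using U by (simp add: normal_imp_subgroup subgroup.subset)
  let ?c = "\<lambda>g. (\<lambda>a. g \<otimes> a \<otimes> inv g) ` S n"
  let ?F = "(\<lambda>((A, g), t). (A \<union> ?c g, g \<otimes> t)) ` (F \<times> T n)"
  have "finite ?F" using F Tn by simp
  moreover have "finite A' \<and> A' \<subseteq> U \<and> card A' \<le> (\<Sum>i<Suc n. card (S i)) \<and> g' \<in> carrier G"
    if A': "(A', g') \<in> ?F" for A' g'
  proof -
    obtain A g t where e: "(A, g) \<in> F" "t \<in> T n" "A' = A \<union> ?c g" "g' = g \<otimes> t"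
      using A' by auto
    have "?c g \<subseteq> U" using FA[OF e(1)] Sn U by (auto simp: normal_inv_iff)
    moreover have "card A' \<le> card A + card (S n)"
      unfolding e using card_Un_le[of A "?c g"] card_image_le[OF Sn(1), of "\<lambda>a. g \<otimes> a \<otimes> inv g"]
      by linarith
    ultimately show ?thesis using FA[OF e(1)] e Sn Tn by auto
  qed
  moreover have "x \<in> (\<Union>(A, g)\<in>?F. generate G A #> g)"
    if x: "x \<in> prod_subgroups G H (Suc n)" for x
  proof -
    obtain p h where ph: "p \<in> prod_subgroups G H n" "h \<in> H n" "x = p \<otimes> h"
      using x by (auto simp: set_mult_def)
    obtain A g where A: "(A, g) \<in> F" "p \<in> generate G A #> g" using F(2) ph by auto
    obtain l where l: "l \<in> generate G A" "p = l \<otimes> g" using A by (auto simp: r_coset_def)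
    obtain t k where t: "t \<in> T n" "k \<in> generate G (S n)" "h = k \<otimes> t"
      using Hn ph by (auto simp: r_coset_def)
    have AG: "A \<subseteq> carrier G" "S n \<subseteq> carrier G" using FA[OF A(1)] Sn UG by auto
    have G: "g \<in> carrier G" "t \<in> carrier G" "l \<in> carrier G" "k \<in> carrier G"
      using FA[OF A(1)] t Tn l AG generate_in_carrier by auto
    have "l \<in> generate G (A \<union> ?c g)" using l mono_generate[of A "A \<union> ?c g"] by auto
    moreover have "g \<otimes> k \<otimes> inv g \<in> generate G (A \<union> ?c g)"
      using conj_mem_generate[OF AG(2) G(1) t(2)] mono_generate[of "?c g" "A \<union> ?c g"] by auto
    ultimately have "l \<otimes> (g \<otimes> k \<otimes> inv g) \<in> generate G (A \<union> ?c g)" by (rule generate.eng)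
    moreover have "x = (l \<otimes> (g \<otimes> k \<otimes> inv g)) \<otimes> (g \<otimes> t)"
      using ph l t G by (simp add: m_assoc inv_mult_cancel_left)
    ultimately have "x \<in> generate G (A \<union> ?c g) #> (g \<otimes> t)" by (auto simp: r_coset_def)
    moreover have "(A \<union> ?c g, g \<otimes> t) \<in> ?F" using A t by force
    ultimately show ?thesis by blast
  qed
  ultimately show ?case by (intro exI[of _ ?F]) blast
qed

section \<open>Rank gradient and infinite index of the pieces\<close>

lemma rank_gradient_le:
  assumes L: "finite_index G (generate G A)" and A: "finite A"
  shows "rank_gradient G * real (index G (generate G A)) \<le> real (card A) - 1"
proof -
  let ?L = "generate G A"
  let ?Q = "{(real (rank G U) - 1) / real (index G U) | U. finite_index G U}"
  have pos: "index G U > 0" if "finite_index G U" for U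
    using that by (auto simp: finite_index_def index_def card_gt_0_iff RCOSETS_def)
  \<comment> \<open>A real \<open>Inf\<close> bounds its members only when the set is bounded below.
    Ranks are at least 0 and indices at least 1, so -1 is a bound.\<close>
  have "bdd_below ?Q"
  proof (rule bdd_belowI)
    fix q assume "q \<in> ?Q"
    then obtain U where U: "q = (real (rank G U) - 1) / real (index G U)" "finite_index G U" by auto
    show "-1 \<le> q" using pos[OF U(2)] by (simp add: U(1) field_simps)
  qed
  moreover have "(real (rank G ?L) - 1) / real (index G ?L) \<in> ?Q" using L by blast
  ultimately have "rank_gradient G \<le> (real (rank G ?L) - 1) / real (index G ?L)"
    unfolding rank_gradient_def by (intro cInf_lower)
  then have "rank_gradient G * real (index G ?L) \<le> real (rank G ?L) - 1"
    using pos[OF L] by (simp add: field_simps)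
  moreover have "rank G ?L \<le> card A"
    unfolding rank_def by (intro Least_le exI[of _ A] conjI refl A) (simp add: generate.incl subsetI)
  ultimately show ?thesis by linarith
qed

end

theorem theorem1p2:
  fixes G :: "('a, 'b) monoid_scheme" and H :: "nat \<Rightarrow> 'a set" and n :: nat
  assumes "group G" and "fg_group G" and "LERF G" and "rank_gradient G > 0"
    and "\<And>i. i < n \<Longrightarrow> fg_subgroup G (H i)"
    and "\<And>i. i < n \<Longrightarrow> \<not> finite (rcosets\<^bsub>G\<^esub> (H i))"
  shows "prod_subgroups G H n \<subset> carrier G"
proof -
  interpret group G by fact
  have "\<exists>S. finite S \<and> S \<subseteq> carrier G \<and> generate G S = H i" if "i < n" for i
    using assms(5)[OF that] by (simp add: fg_subgroup_def)
  then obtain S where S: "\<And>i. i < n \<Longrightarrow> finite (S i) \<and> S i \<subseteq> carrier G \<and> generate G (S i) = H i"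
    by metis
  have HG: "H i \<subseteq> carrier G" if "i < n" for i
    using assms(5)[OF that] by (simp add: fg_subgroup_def subgroup.subset)
  define D where "D = (\<Sum>i<n. card (S i))"
  \<comment> \<open>\<open>M\<close> is the index to demand of the overgroups of the
    \<open>H i\<close>: it makes \<open>D / M\<close> smaller than the rank gradient.\<close>
  obtain M :: nat where M: "real D < real M * rank_gradient G"
    using reals_Archimedean3[OF assms(4)] by blast
  have "\<exists>V. finite_index G V \<and> H i \<subseteq> V \<and> M \<le> index G V" if "i < n" for i
    using exists_finite_index_large[OF assms(3,5,6)] that by blast
  then obtain V where V: "\<And>i. i < n \<Longrightarrow> finite_index G (V i) \<and> H i \<subseteq> V i \<and> M \<le> index G (V i)"
    by metis
  obtain U where U: "U \<lhd> G" "finite_index G U" "\<And>i. i < n \<Longrightarrow> U \<subseteq> V i"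
    using exists_normal_core[of "{..<n}" V] V by auto
  have Us: "subgroup U G" "finite (rcosets\<^bsub>G\<^esub> U)" using U by (auto simp: finite_index_def)
  have UG: "U \<subseteq> carrier G" using Us by (simp add: subgroup.subset)
  let ?X = "\<lambda>i. (\<lambda>h. U #>\<^bsub>G\<^esub> h) ` H i"
  \<comment> \<open>Each \<open>H i\<close> meets at most the fraction \<open>1 / M\<close> of the
    cosets of \<open>U\<close>.\<close>
  have X: "card (?X i) * M \<le> index G U" if "i < n" for i
  proof -
    have "card (?X i) * M \<le> card (?X i) * card (rcosets\<^bsub>G\<^esub> (V i))"
      using V[OF that] by (simp add: index_def)
    also have "\<dots> \<le> index G U" unfolding index_def
      by (rule card_rcosets_mult_le) (use V U that Us in \<open>auto simp: finite_index_def\<close>)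
    finally show ?thesis .
  qed
  have "\<exists>S' T. finite S' \<and> S' \<subseteq> U \<and> card S' \<le> card (S i) * card (?X i)
    \<and> finite T \<and> T \<subseteq> carrier G \<and> H i \<subseteq> (\<Union>t\<in>T. generate G S' #>\<^bsub>G\<^esub> t)" if "i < n" for i
  proof -
    have "finite (?X i)"
      by (rule finite_subset[OF _ Us(2)]) (use HG[OF that] in \<open>auto simp: RCOSETS_def\<close>)
    then show ?thesis using Schreier_generators[of "S i" U] S[OF that] Us by simp
  qed
  then obtain S' T where S': "\<And>i. i < n \<Longrightarrow> card (S' i) \<le> card (S i) * card (?X i)"
    and cover: "\<forall>i<n. finite (S' i) \<and> S' i \<subseteq> U \<and> finite (T i) \<and> T i \<subseteq> carrier G
      \<and> H i \<subseteq> (\<Union>t\<in>T i. generate G (S' i) #>\<^bsub>G\<^esub> t)"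
    by metis
  obtain F where F: "finite F"
      "prod_subgroups G H n \<subseteq> (\<Union>(A, g)\<in>F. generate G A #>\<^bsub>G\<^esub> g)"
    and "\<forall>(A, g)\<in>F. finite A \<and> A \<subseteq> U \<and> card A \<le> (\<Sum>i<n. card (S' i)) \<and> g \<in> carrier G"
    using prod_subgroups_coset_cover[OF U(1) cover] by (elim exE conjE) (rule that)
  then have FA: "finite A \<and> A \<subseteq> U \<and> card A \<le> (\<Sum>i<n. card (S' i)) \<and> g \<in> carrier G"
    if "(A, g) \<in> F" for A g
    using that by fast
  \<comment> \<open>Every piece thus has at most \<open>D / M\<close> times \<open>index G U\<close>
    generators; the denominator is cleared to stay in the naturals.\<close>
  have sum: "(\<Sum>i<n. card (S' i)) * M \<le> D * index G U"
  proof -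
    have "card (S' i) * M \<le> card (S i) * index G U" if "i < n" for i
    proof -
      have "card (S' i) * M \<le> card (S i) * (card (?X i) * M)"
        using mult_le_mono1[OF S'[OF that], of M] by (simp add: mult.assoc)
      also have "\<dots> \<le> card (S i) * index G U" using X[OF that] by simp
      finally show ?thesis .
    qed
    then show ?thesis unfolding D_def sum_distrib_right by (intro sum_mono) auto
  qed
  have inf: "infinite (rcosets\<^bsub>G\<^esub> (generate G A))" if "(A, g) \<in> F" for A g
  proof
    let ?L = "generate G A"
    assume fin: "finite (rcosets\<^bsub>G\<^esub> ?L)"
    have A: "finite A" "A \<subseteq> U" "card A \<le> (\<Sum>i<n. card (S' i))" using FA[OF that] by auto
    have L: "subgroup ?L G" using generate_is_subgroup A UG by blast
    have LU: "?L \<subseteq> U" using generate_subgroup_incl[OF A(2) Us(1)] .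
    \<comment> \<open>With a single element, the coset count reduces to monotonicity of the
      index.\<close>
    have "card ((\<lambda>h. ?L #>\<^bsub>G\<^esub> h) ` {\<one>\<^bsub>G\<^esub>}) * card (rcosets\<^bsub>G\<^esub> U) \<le> card (rcosets\<^bsub>G\<^esub> ?L)"
      by (rule card_rcosets_mult_le) (use Us L LU fin in \<open>auto simp: subgroup.one_closed\<close>)
    then have idx: "index G U \<le> index G ?L" by (simp add: index_def)
    have "rank_gradient G * real (index G U) \<le> rank_gradient G * real (index G ?L)"
      using idx assms(4) by simp
    also have "\<dots> \<le> real (card A) - 1"
      using rank_gradient_le A L fin by (simp add: finite_index_def)
    \<comment> \<open>The -1 in the rank gradient makes this strict, so weak inequalities suffice to
      return to the starting quantity.\<close>
    finally have "rank_gradient G * real (index G U) < real (card A)" by simp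
    moreover have M0: "M > 0" using M by (cases M) auto
    ultimately have "real M * (rank_gradient G * real (index G U)) < real M * real (card A)" by simp
    also have "\<dots> \<le> real ((\<Sum>i<n. card (S' i)) * M)"
      using A(3) by (simp add: mult.commute flip: of_nat_mult of_nat_sum)
    also have "\<dots> \<le> real (D * index G U)" using sum of_nat_mono by blast
    also have "\<dots> \<le> (real M * rank_gradient G) * real (index G U)"
      using M by (simp add: mult_right_mono)
    finally show False by simp
  qed
  have "prod_subgroups G H n \<subseteq> carrier G" using HG
    by (induction n) (auto simp: set_mult_def subset_iff less_Suc_eq)
  moreover have "prod_subgroups G H n \<noteq> carrier G"
  proof
    assume eq: "prod_subgroups G H n = carrier G"
    \<comment> \<open>If the product were all of \<open>G\<close>, the pieces would cover
      \<open>G\<close> and one of them would have finite index, against \<open>inf\<close>.\<close>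
    let ?F = "(\<lambda>(A, g). (generate G A, g)) ` F"
    have "\<exists>(L, g)\<in>?F. finite (rcosets\<^bsub>G\<^esub> L)"
    proof (rule finite_coset_cover_finite_index[OF assms(3)])
      show "finite ?F" using F by simp
      show "carrier G \<subseteq> (\<Union>(L, g)\<in>?F. L #>\<^bsub>G\<^esub> g)" using F(2) eq by force
      fix L g assume "(L, g) \<in> ?F"
      then obtain A where A: "(A, g) \<in> F" "L = generate G A" by auto
      then show "g \<in> carrier G" using FA by blast
      have "finite A" "A \<subseteq> carrier G" using FA[OF A(1)] UG by auto
      then show "fg_subgroup G L"
        using A generate_is_subgroup by (auto simp: fg_subgroup_def)
    qed
    then show False using inf by auto
  qed
  ultimately show ?thesis by blast
qed

end
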